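(* Let $(\Omega,\mathcal{H},\hat{E})$ be a sublinear expectation space as in the context, and let $\{X_n,n\ge 1\}\subset\mathcal{H}$ be a sequence of i.i.d. random variables under $\hat{E}$ with $\hat{E}[X_n]=-\hat{E}[-X_n]=\mu$ for all $n\ge 1$. Put $S_n=X_1+\cdots+X_n$. Suppose that $\hat{E}[|X_1|^{\alpha}]<\infty$ for some $\alpha>2$. Then: (i) if $0<p\le 2$, then $\frac{S_n}{n}$ does not $S\text{-}L^p$ converge to $\mu$, i.e. $\sum_{n=1}^{\infty}\hat{E}\left[\left|\frac{S_n}{n}-\mu\right|^{p}\right]=\infty$; (ii) if $2<p\le\alpha$, then $\frac{S_n}{n}$ $S\text{-}L^p$ converges to $\mu$, i.e. $\sum_{n=1}^{\infty}\hat{E}\left[\left|\frac{S_n}{n}-\mu\right|^{p}\right]<\infty$.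
   Context: Setting. $\Omega$ is a complete separable metric space with Borel $\sigma$-algebra $\mathcal{B}(\Omega)$. $\mathcal{H}$ is a linear space of real functions on $\Omega$ that contains all constants, contains $|X|$ whenever $X\in\mathcal{H}$, contains $\varphi(X_1,\dots,X_n)$ whenever $X_1,\dots,X_n\in\mathcal{H}$ and $\varphi\in C_{l,lip}(\mathbb{R}^n)$, and contains the indicator $I_A$ for every $A\in\mathcal{B}(\Omega)$. Here $C_{l,lip}(\mathbb{R}^n)$ is the linear space of functions $\varphi:\mathbb{R}^n\to\mathbb{R}$ satisfying $|\varphi(x)-\varphi(y)|\le C(1+|x|^m+|y|^m)|x-y|$ for all $x,y\in\mathbb{R}^n$, for some $C>0$, $m\in\mathbb{N}$ depending on $\varphi$. $\mathcal{H}^n$ denotes the set of vectors $(X_1,\dots,X_n)$ with all $X_i\in\mathcal{H}$. A sublinear expectation is a functional $\hat{E}:\mathcal{H}\to\mathbb{R}$ such that for all $X,Y\in\mathcal{H}$: $\hat{E}[X]\ge\hat{E}[Y]$ if $X\ge Y$; $\hat{E}[c]=c$ for $c\in\mathbb{R}$; $\hat{E}[X+Y]\le\hat{E}[X]+\hat{E}[Y]$; $\hat{E}[\lambda X]=\lambda\hat{E}[X]$ for $\lambda\ge0$. The triple $(\Omega,\mathcal{H},\hat{E})$ is a sublinear expectation space. It is assumed that there is a family $\mathcal{P}$ of probability measures on $(\Omega,\mathcal{B}(\Omega))$ with $\hat{E}[X]=\sup_{P\in\mathcal{P}}E_P[X]$ for all $X\in\mathcal{H}$. Identical distribution: $X,Y\in\mathcal{H}$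 satisfy $X\stackrel{d}{=}Y$ if $\hat{E}[\varphi(X)]=\hat{E}[\varphi(Y)]$ for all $\varphi\in C_{l,lip}(\mathbb{R})$. Independence: for $X\in\mathcal{H}^m$, $Y\in\mathcal{H}^n$, $Y$ is independent to $X$ if for every $\varphi\in C_{l,lip}(\mathbb{R}^{m+n})$, $\hat{E}[\varphi(X,Y)]=\hat{E}\big[\hat{E}[\varphi(x,Y)]_{x=X}\big]$ whenever $\bar\varphi(x):=\hat{E}[|\varphi(x,Y)|]<\infty$ for all $x$ and $\hat{E}[|\bar\varphi(X)|]<\infty$. A sequence $\{X_n,n\ge1\}\subset\mathcal{H}$ is i.i.d. if for each $i\ge1$, $X_i\stackrel{d}{=}X_1$ and $X_{i+1}$ is independent to $(X_1,\dots,X_i)$. For $p>0$, $Y_n$ is said to $S\text{-}L^p$ converge to $Y$ if $\sum_{n=1}^\infty\hat{E}[|Y_n-Y|^p]<\infty$.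
   Formalization: Part (i) is proved under the added assumption that Ê[|X_1 − μ|] > 0; without it (i) is false, since for X_n = μ for all n every term of the series is 0, and it fails in exactly the excluded cases. *)

theory Defs
  imports "HOL-Probability.Probability"
begin

text \<open>
  A vector in \<open>\<real>\<^sup>n\<close> is the tuple of the values at \<open>0, \<dots>, n - 1\<close> of a function \<open>nat \<Rightarrow> real\<close>, so that
  the dimension can vary inside a formula. The growth condition below only involves these
  coordinates; since its right-hand side vanishes when \<open>x\<close> and \<open>y\<close> agree on them, a member of
  \<open>C_llip n\<close> depends on them alone, i.e. it is a function on \<open>\<real>\<^sup>n\<close>.
\<close>

definition C_llip :: "nat \<Rightarrow> ((nat \<Rightarrow> real) \<Rightarrow> real) set" where
  "C_llip n = {\<phi>. \<exists>C>0. \<exists>m::nat. \<forall>x y.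
     \<bar>\<phi> x - \<phi> y\<bar> \<le> C * (1 + L2_set x {..<n} ^ m + L2_set y {..<n} ^ m)
                     * L2_set (\<lambda>i. x i - y i) {..<n}}"

definition vec_append :: "nat \<Rightarrow> (nat \<Rightarrow> real) \<Rightarrow> (nat \<Rightarrow> real) \<Rightarrow> nat \<Rightarrow> real" where
  "vec_append m x y = (\<lambda>k. if k < m then x k else y (k - m))"

text \<open>
  The functional \<open>E\<close> is only meaningful on \<open>H\<close>. In \<open>represents\<close>, integrability makes
  \<open>E\<^sub>P[X]\<close> meaningful (the Bochner integral is \<open>0\<close> for non-integrable functions), and taking the
  supremum in \<open>ereal\<close> makes the equation entail that \<open>\<P>\<close> is nonempty and the supremum finite.
\<close>

locale sublinear_expectation_space =
  fixes H :: "('a::polish_space \<Rightarrow> real) set"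
    and E :: "('a \<Rightarrow> real) \<Rightarrow> real"
    and \<P> :: "'a measure set"
  assumes H_add: "X \<in> H \<Longrightarrow> Y \<in> H \<Longrightarrow> (\<lambda>\<omega>. X \<omega> + Y \<omega>) \<in> H"
    and H_scale: "X \<in> H \<Longrightarrow> (\<lambda>\<omega>. c * X \<omega>) \<in> H"
    and H_const: "(\<lambda>\<omega>. c) \<in> H"
    and H_abs: "X \<in> H \<Longrightarrow> (\<lambda>\<omega>. \<bar>X \<omega>\<bar>) \<in> H"
    and H_C_llip: "\<phi> \<in> C_llip n \<Longrightarrow> (\<And>i. i < n \<Longrightarrow> Z i \<in> H) \<Longrightarrow> (\<lambda>\<omega>. \<phi> (\<lambda>i. Z i \<omega>)) \<in> H"
    and H_indicator: "A \<in> sets borel \<Longrightarrow> indicat_real A \<in> H"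
    and E_mono: "X \<in> H \<Longrightarrow> Y \<in> H \<Longrightarrow> (\<And>\<omega>. Y \<omega> \<le> X \<omega>) \<Longrightarrow> E Y \<le> E X"
    and E_const: "E (\<lambda>\<omega>. c) = c"
    and E_subadd: "X \<in> H \<Longrightarrow> Y \<in> H \<Longrightarrow> E (\<lambda>\<omega>. X \<omega> + Y \<omega>) \<le> E X + E Y"
    and E_scale: "X \<in> H \<Longrightarrow> 0 \<le> l \<Longrightarrow> E (\<lambda>\<omega>. l * X \<omega>) = l * E X"
    and prob_P: "P \<in> \<P> \<Longrightarrow> prob_space P"
    and sets_P: "P \<in> \<P> \<Longrightarrow> sets P = sets borel"
    and integrable_H: "P \<in> \<P> \<Longrightarrow> X \<in> H \<Longrightarrow> integrable P X"
    and represents: "X \<in> H \<Longrightarrow> ereal (E X) = (SUP P\<in>\<P>. ereal (\<integral>\<omega>. X \<omega> \<partial>P))"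

text \<open>
  The extension of \<open>E\<close> to nonnegative Borel functions, possibly infinite or outside \<open>H\<close>:
  for \<open>p < 1\<close> the function \<open>\<lambda>x. \<bar>x\<bar> powr p\<close> is not locally Lipschitz at \<open>0\<close>, so
  \<open>\<bar>Y\<bar> powr p\<close> need not lie in \<open>H\<close> for \<open>Y \<in> H\<close>.
\<close>

definition upper_expectation :: "'a measure set \<Rightarrow> ('a \<Rightarrow> ennreal) \<Rightarrow> ennreal" where
  "upper_expectation \<P> f = (SUP P\<in>\<P>. \<integral>\<^sup>+\<omega>. f \<omega> \<partial>P)"

lemma (in sublinear_expectation_space) upper_expectation_eq:
  assumes "X \<in> H" and "\<And>\<omega>. 0 \<le> X \<omega>"
  shows "upper_expectation \<P> (\<lambda>\<omega>. ennreal (X \<omega>)) = ennreal (E X)"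
proof -
  have eq: "(\<integral>\<^sup>+\<omega>. ennreal (X \<omega>) \<partial>P) = ennreal (\<integral>\<omega>. X \<omega> \<partial>P)" if "P \<in> \<P>" for P
    using that assms by (simp add: nn_integral_eq_integral integrable_H)
  show ?thesis
  proof (rule antisym)
    have "(\<integral>\<omega>. X \<omega> \<partial>P) \<le> E X" if "P \<in> \<P>" for P
    proof -
      have "ereal (\<integral>\<omega>. X \<omega> \<partial>P) \<le> ereal (E X)"
        unfolding represents[OF assms(1)] using that by (rule SUP_upper)
      then show ?thesis by simp
    qed
    then show "upper_expectation \<P> (\<lambda>\<omega>. ennreal (X \<omega>)) \<le> ennreal (E X)"
      unfolding upper_expectation_def by (intro SUP_least) (simp add: eq ennreal_leI)
  next
    show "ennreal (E X) \<le> upper_expectation \<P> (\<lambda>\<omega>. ennreal (X \<omega>))"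
    proof (cases "upper_expectation \<P> (\<lambda>\<omega>. ennreal (X \<omega>))")
      case (real u)
      have "(\<integral>\<omega>. X \<omega> \<partial>P) \<le> u" if "P \<in> \<P>" for P
      proof -
        have "ennreal (\<integral>\<omega>. X \<omega> \<partial>P) \<le> ennreal u"
          using SUP_upper[OF that, of "\<lambda>P. \<integral>\<^sup>+\<omega>. ennreal (X \<omega>) \<partial>P"] real eq[OF that]
          by (simp add: upper_expectation_def)
        then show ?thesis using real by simp
      qed
      then have "ereal (E X) \<le> ereal u"
        unfolding represents[OF assms(1)] by (intro SUP_least) simp
      then show ?thesis using real by (simp add: ennreal_leI)
    qed simp
  qed
qed

definition identically_distributed ::
  "(('a \<Rightarrow> real) \<Rightarrow> real) \<Rightarrow> ('a \<Rightarrow> real) \<Rightarrow> ('a \<Rightarrow> real) \<Rightarrow> bool" where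
  "identically_distributed E X Y \<longleftrightarrow>
     (\<forall>\<phi>\<in>C_llip 1. E (\<lambda>\<omega>. \<phi> (\<lambda>_. X \<omega>)) = E (\<lambda>\<omega>. \<phi> (\<lambda>_. Y \<omega>)))"

text \<open>The random vector \<open>Y\<close>, with \<open>n\<close> components, is independent to \<open>X\<close>, with \<open>m\<close> components.\<close>

definition independent_to ::
  "(('a \<Rightarrow> real) \<Rightarrow> real) \<Rightarrow> 'a measure set \<Rightarrow>
   nat \<Rightarrow> (nat \<Rightarrow> 'a \<Rightarrow> real) \<Rightarrow> nat \<Rightarrow> (nat \<Rightarrow> 'a \<Rightarrow> real) \<Rightarrow> bool" where
  "independent_to E \<P> n Y m X \<longleftrightarrow>
     (\<forall>\<phi>\<in>C_llip (m + n).
        let bar = (\<lambda>x. upper_expectation \<P> (\<lambda>\<omega>. ennreal \<bar>\<phi> (vec_append m x (\<lambda>j. Y j \<omega>))\<bar>)) in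
        (\<forall>x. bar x < \<infinity>) \<longrightarrow>
        upper_expectation \<P> (\<lambda>\<omega>. bar (\<lambda>i. X i \<omega>)) < \<infinity> \<longrightarrow>
        E (\<lambda>\<omega>. \<phi> (vec_append m (\<lambda>i. X i \<omega>) (\<lambda>j. Y j \<omega>))) =
        E (\<lambda>\<omega>. E (\<lambda>\<omega>'. \<phi> (vec_append m (\<lambda>i. X i \<omega>) (\<lambda>j. Y j \<omega>')))))"

text \<open>
  Sequences are indexed from \<open>1\<close>, the value at \<open>0\<close> being irrelevant, whereas components of
  random vectors are indexed from \<open>0\<close>.
\<close>

definition iid_sequence ::
  "('a \<Rightarrow> real) set \<Rightarrow> (('a \<Rightarrow> real) \<Rightarrow> real) \<Rightarrow> 'a measure set \<Rightarrow> (nat \<Rightarrow> 'a \<Rightarrow> real) \<Rightarrow> bool" where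
  "iid_sequence H E \<P> X \<longleftrightarrow>
     (\<forall>i\<ge>1. X i \<in> H \<and> identically_distributed E (X i) (X 1) \<and>
            independent_to E \<P> 1 (\<lambda>_. X (i + 1)) i (\<lambda>k. X (k + 1)))"

definition SLp_converges ::
  "'a measure set \<Rightarrow> real \<Rightarrow> (nat \<Rightarrow> 'a \<Rightarrow> real) \<Rightarrow> ('a \<Rightarrow> real) \<Rightarrow> bool" where
  "SLp_converges \<P> p Y Z \<longleftrightarrow>
     (\<Sum>n. upper_expectation \<P> (\<lambda>\<omega>. ennreal (\<bar>Y (Suc n) \<omega> - Z \<omega>\<bar> powr p))) < \<infinity>"

end

theory Submission
  imports Defs
begin

text \<open>
  Let \<open>T\<^sub>n = S\<^sub>n - n \<mu>\<close>. Since the mean of each summand \<open>Y = X - \<mu>\<close> is certain, independence makes the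
  terms linear in \<open>Y\<close> vanish when powers of \<open>T\<^sub>n + Y\<close> are expanded. Hence \<open>E[T\<^sub>n\<^sup>2] = n \<sigma>\<^sup>2\<close>, and by
  induction on \<open>k\<close> the even moments satisfy \<open>E[T\<^sub>n\<^sup>2\<^sup>k] \<le> C\<^sub>k n\<^sup>k\<close>; all of them are finite because \<open>H\<close> is
  closed under polynomials and \<open>E\<close> is real-valued on \<open>H\<close>. For \<open>p > 2\<close> an even moment of order at least
  \<open>p\<close> gives \<open>E[\<bar>T\<^sub>n / n\<bar>\<^sup>p] \<le> C n\<^bsup>-p/2\<^esup>\<close>, which is summable. For \<open>p \<le> 2\<close> the second moment is
  interpolated between the moments of order \<open>p\<close> and \<open>4\<close>, which bounds \<open>E[\<bar>T\<^sub>n / n\<bar>\<^sup>p]\<close> below by a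
  multiple of \<open>1 / n\<close>.
\<close>

section \<open>Locally Lipschitz functions of polynomial growth\<close>

text \<open>A power of the single base 1 + |x| + |y|, which is at least 1, is monotone in its
  exponent and turns products of bounds into sums of exponents. The two growth factors agree up to
  the constants 3 and 3^m.\<close>

lemma C_llip_iff:
  "\<phi> \<in> C_llip n \<longleftrightarrow> (\<exists>C m. 0 \<le> C \<and> (\<forall>x y. \<bar>\<phi> x - \<phi> y\<bar> \<le>
     C * (1 + L2_set x {..<n} + L2_set y {..<n}) ^ m * L2_set (\<lambda>i. x i - y i) {..<n}))"
proof
  assume "\<phi> \<in> C_llip n"
  then obtain C m where C: "0 < C" and le: "\<And>x y. \<bar>\<phi> x - \<phi> y\<bar> \<le>
      C * (1 + L2_set x {..<n} ^ m + L2_set y {..<n} ^ m) * L2_set (\<lambda>i. x i - y i) {..<n}"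
    unfolding C_llip_def by blast
  have "\<bar>\<phi> x - \<phi> y\<bar> \<le> (3 * C) * (1 + L2_set x {..<n} + L2_set y {..<n}) ^ m
      * L2_set (\<lambda>i. x i - y i) {..<n}" for x y
  proof -
    let ?b = "1 + L2_set x {..<n} + L2_set y {..<n}"
    have "1 \<le> ?b ^ m" "L2_set x {..<n} ^ m \<le> ?b ^ m" "L2_set y {..<n} ^ m \<le> ?b ^ m"
      by (auto intro!: one_le_power power_mono)
    then have "1 + L2_set x {..<n} ^ m + L2_set y {..<n} ^ m \<le> 3 * ?b ^ m"
      by linarith
    then have "C * (1 + L2_set x {..<n} ^ m + L2_set y {..<n} ^ m) \<le> C * (3 * ?b ^ m)"
      using C by (intro mult_left_mono) simp_all
    from mult_right_mono[OF this, of "L2_set (\<lambda>i. x i - y i) {..<n}"] le[of x y]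
    show ?thesis by (simp add: mult_ac)
  qed
  then show "\<exists>C m. 0 \<le> C \<and> (\<forall>x y. \<bar>\<phi> x - \<phi> y\<bar> \<le>
      C * (1 + L2_set x {..<n} + L2_set y {..<n}) ^ m * L2_set (\<lambda>i. x i - y i) {..<n})"
    using C by (intro exI[of _ "3 * C"] exI[of _ m]) auto
next
  assume "\<exists>C m. 0 \<le> C \<and> (\<forall>x y. \<bar>\<phi> x - \<phi> y\<bar> \<le>
      C * (1 + L2_set x {..<n} + L2_set y {..<n}) ^ m * L2_set (\<lambda>i. x i - y i) {..<n})"
  then obtain C m where C: "0 \<le> C" and le: "\<And>x y. \<bar>\<phi> x - \<phi> y\<bar> \<le>
      C * (1 + L2_set x {..<n} + L2_set y {..<n}) ^ m * L2_set (\<lambda>i. x i - y i) {..<n}"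
    by blast
  \<comment> \<open>\<open>C + 1\<close> replaces \<open>C\<close> because \<open>C_llip\<close>
    asks for a strictly positive constant.\<close>
  have "\<bar>\<phi> x - \<phi> y\<bar> \<le> ((C + 1) * 3 ^ m) * (1 + L2_set x {..<n} ^ m + L2_set y {..<n} ^ m)
      * L2_set (\<lambda>i. x i - y i) {..<n}" for x y
  proof -
    let ?a = "L2_set x {..<n}" and ?b = "L2_set y {..<n}"
    define M where "M = max 1 (max ?a ?b)"
    have "(1 + ?a + ?b) ^ m \<le> (3 * M) ^ m"
      unfolding M_def by (intro power_mono) auto
    also have "M ^ m \<le> 1 + ?a ^ m + ?b ^ m"
    proof -
      have "M = 1 \<or> M = ?a \<or> M = ?b" unfolding M_def by linarith
      then show ?thesis by (auto simp: add_nonneg_nonneg)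
    qed
    then have "(3 * M) ^ m \<le> 3 ^ m * (1 + ?a ^ m + ?b ^ m)"
      by (simp add: power_mult_distrib)
    finally have "C * (1 + ?a + ?b) ^ m \<le> (C + 1) * (3 ^ m * (1 + ?a ^ m + ?b ^ m))"
      using C by (intro mult_mono) auto
    from mult_right_mono[OF this, of "L2_set (\<lambda>i. x i - y i) {..<n}"] le[of x y]
    show ?thesis by (simp add: mult_ac)
  qed
  then show "\<phi> \<in> C_llip n"
    unfolding C_llip_def using C
    by (intro CollectI exI[of _ "(C + 1) * 3 ^ m"] exI[of _ m] conjI allI) auto
qed

text \<open>Comparison with the value at the origin; one extra power absorbs the distance
  factor.\<close>

lemma C_llip_growth:
  assumes "\<phi> \<in> C_llip n"
  obtains C m where "0 \<le> C" "\<And>x. \<bar>\<phi> x\<bar> \<le> C * (1 + L2_set x {..<n}) ^ m"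
proof -
  obtain C m where C: "0 \<le> C" and le: "\<And>x y. \<bar>\<phi> x - \<phi> y\<bar> \<le>
      C * (1 + L2_set x {..<n} + L2_set y {..<n}) ^ m * L2_set (\<lambda>i. x i - y i) {..<n}"
    using assms unfolding C_llip_iff by blast
  have "\<bar>\<phi> x\<bar> \<le> (\<bar>\<phi> (\<lambda>_. 0)\<bar> + C) * (1 + L2_set x {..<n}) ^ Suc m" for x
  proof -
    let ?b = "1 + L2_set x {..<n}"
    have "\<bar>\<phi> x\<bar> \<le> \<bar>\<phi> (\<lambda>_. 0)\<bar> + \<bar>\<phi> x - \<phi> (\<lambda>_. 0)\<bar>" by linarith
    also have "\<bar>\<phi> x - \<phi> (\<lambda>_. 0)\<bar> \<le> C * ?b ^ m * L2_set x {..<n}"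
      using le[of x "\<lambda>_. 0"] by (simp add: L2_set_def)
    also have "C * ?b ^ m * L2_set x {..<n} \<le> C * ?b ^ m * ?b"
      using C by (intro mult_left_mono) auto
    also have "\<bar>\<phi> (\<lambda>_. 0)\<bar> \<le> \<bar>\<phi> (\<lambda>_. 0)\<bar> * ?b ^ Suc m"
      using one_le_power[of ?b "Suc m"] by (simp add: mult_le_cancel_left1 del: power_Suc)
    finally show ?thesis by (simp add: algebra_simps)
  qed
  then show thesis using C by (intro that[of "\<bar>\<phi> (\<lambda>_. 0)\<bar> + C" "Suc m"]) auto
qed

lemma C_llip_const: "(\<lambda>_. c) \<in> C_llip n"
  unfolding C_llip_iff by (intro exI[of _ 0]) auto

lemma C_llip_proj:
  assumes "i < n"
  shows "(\<lambda>x. x i) \<in> C_llip n"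
proof -
  have "\<bar>x i - y i\<bar> \<le> L2_set (\<lambda>i. x i - y i) {..<n}" for x y
    using member_le_L2_set[of "{..<n}" i "\<lambda>i. \<bar>x i - y i\<bar>"] assms by (simp add: L2_set_def)
  then show ?thesis unfolding C_llip_iff by (intro exI[of _ 1] exI[of _ 0]) auto
qed

lemma C_llip_add:
  assumes "f \<in> C_llip n" "g \<in> C_llip n"
  shows "(\<lambda>x. f x + g x) \<in> C_llip n"
proof -
  obtain C m where C: "0 \<le> C" and f: "\<And>x y. \<bar>f x - f y\<bar> \<le>
      C * (1 + L2_set x {..<n} + L2_set y {..<n}) ^ m * L2_set (\<lambda>i. x i - y i) {..<n}"
    using assms(1) unfolding C_llip_iff by blast
  obtain D k where D: "0 \<le> D" and g: "\<And>x y. \<bar>g x - g y\<bar> \<le>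
      D * (1 + L2_set x {..<n} + L2_set y {..<n}) ^ k * L2_set (\<lambda>i. x i - y i) {..<n}"
    using assms(2) unfolding C_llip_iff by blast
  have "\<bar>f x + g x - (f y + g y)\<bar> \<le> (C + D) *
      (1 + L2_set x {..<n} + L2_set y {..<n}) ^ (m + k) * L2_set (\<lambda>i. x i - y i) {..<n}" for x y
  proof -
    let ?b = "1 + L2_set x {..<n} + L2_set y {..<n}" and ?d = "L2_set (\<lambda>i. x i - y i) {..<n}"
    have "C * ?b ^ m * ?d \<le> C * ?b ^ (m + k) * ?d"
      using C by (intro mult_right_mono mult_left_mono power_increasing) auto
    moreover have "D * ?b ^ k * ?d \<le> D * ?b ^ (m + k) * ?d"
      using D by (intro mult_right_mono mult_left_mono power_increasing) auto
    ultimately have "C * ?b ^ m * ?d + D * ?b ^ k * ?d \<le> (C + D) * ?b ^ (m + k) * ?d"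
      by (simp add: distrib_right)
    then show ?thesis using f[of x y] g[of x y] by linarith
  qed
  then show ?thesis unfolding C_llip_iff
    using C D by (intro exI[of _ "C + D"] exI[of _ "m + k"]) auto
qed

text \<open>The difference of products is f(x) (g(x) - g(y)) + g(y) (f(x) - f(y)): in each term one
  factor grows polynomially and the other carries the Lipschitz bound.\<close>

lemma C_llip_mult:
  assumes "f \<in> C_llip n" "g \<in> C_llip n"
  shows "(\<lambda>x. f x * g x) \<in> C_llip n"
proof -
  obtain C m where C: "0 \<le> C" and f: "\<And>x y. \<bar>f x - f y\<bar> \<le>
      C * (1 + L2_set x {..<n} + L2_set y {..<n}) ^ m * L2_set (\<lambda>i. x i - y i) {..<n}"
    using assms(1) unfolding C_llip_iff by blast
  obtain D k where D: "0 \<le> D" and g: "\<And>x y. \<bar>g x - g y\<bar> \<le>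
      D * (1 + L2_set x {..<n} + L2_set y {..<n}) ^ k * L2_set (\<lambda>i. x i - y i) {..<n}"
    using assms(2) unfolding C_llip_iff by blast
  obtain C' m' where C': "0 \<le> C'" and f': "\<And>x. \<bar>f x\<bar> \<le> C' * (1 + L2_set x {..<n}) ^ m'"
    using C_llip_growth[OF assms(1)] by blast
  obtain D' k' where D': "0 \<le> D'" and g': "\<And>x. \<bar>g x\<bar> \<le> D' * (1 + L2_set x {..<n}) ^ k'"
    using C_llip_growth[OF assms(2)] by blast
  define N where "N = m + k + m' + k'"
  have "\<bar>f x * g x - f y * g y\<bar> \<le> (C' * D + D' * C) *
      (1 + L2_set x {..<n} + L2_set y {..<n}) ^ N * L2_set (\<lambda>i. x i - y i) {..<n}" for x y
  proof -
    let ?b = "1 + L2_set x {..<n} + L2_set y {..<n}" and ?d = "L2_set (\<lambda>i. x i - y i) {..<n}"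
    have fx: "\<bar>f x\<bar> \<le> C' * ?b ^ m'"
      by (rule order_trans[OF f']) (use C' in \<open>auto intro!: mult_left_mono power_mono\<close>)
    have gy: "\<bar>g y\<bar> \<le> D' * ?b ^ k'"
      by (rule order_trans[OF g']) (use D' in \<open>auto intro!: mult_left_mono power_mono\<close>)
    have "\<bar>f x * g x - f y * g y\<bar> = \<bar>f x * (g x - g y) + g y * (f x - f y)\<bar>"
      by (simp add: algebra_simps)
    also have "\<dots> \<le> \<bar>f x\<bar> * \<bar>g x - g y\<bar> + \<bar>g y\<bar> * \<bar>f x - f y\<bar>"
      by (metis abs_mult abs_triangle_ineq)
    also have "\<dots> \<le> (C' * ?b ^ m') * (D * ?b ^ k * ?d) + (D' * ?b ^ k') * (C * ?b ^ m * ?d)"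
      using C' D' by (intro add_mono mult_mono fx gy f g) auto
    also have "\<dots> = C' * D * ?b ^ (m' + k) * ?d + D' * C * ?b ^ (k' + m) * ?d"
      by (simp add: power_add mult_ac)
    also have "\<dots> \<le> C' * D * ?b ^ N * ?d + D' * C * ?b ^ N * ?d"
    proof -
      have "?b ^ (m' + k) \<le> ?b ^ N" "?b ^ (k' + m) \<le> ?b ^ N"
        unfolding N_def by (intro power_increasing; simp)+
      then show ?thesis using C C' D D'
        by (intro add_mono mult_right_mono mult_left_mono) auto
    qed
    finally show ?thesis by (simp add: distrib_right)
  qed
  then show ?thesis unfolding C_llip_iff
    using C D C' D' by (intro exI[of _ "C' * D + D' * C"] exI[of _ N]) auto
qed

lemma C_llip_power: "f \<in> C_llip n \<Longrightarrow> (\<lambda>x. f x ^ k) \<in> C_llip n"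
  by (induction k) (auto intro: C_llip_mult C_llip_const)

lemma C_llip_diff: "f \<in> C_llip n \<Longrightarrow> g \<in> C_llip n \<Longrightarrow> (\<lambda>x. f x - g x) \<in> C_llip n"
  using C_llip_add[of f n "\<lambda>x. (-1) * g x"] C_llip_mult[OF C_llip_const[of "-1"], of g n] by simp

lemma C_llip_sum: "(\<And>i. i \<in> I \<Longrightarrow> f i \<in> C_llip n) \<Longrightarrow> (\<lambda>x. \<Sum>i\<in>I. f i x) \<in> C_llip n"
  by (induction I rule: infinite_finite_induct) (auto intro: C_llip_add C_llip_const)

lemmas C_llip_intros = C_llip_const C_llip_proj C_llip_add C_llip_diff C_llip_mult C_llip_power
  C_llip_sum

lemma vec_append_less: "i < m \<Longrightarrow> vec_append m x y i = x i"
  by (simp add: vec_append_def)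

lemma vec_append_last: "vec_append m x y m = y 0"
  by (simp add: vec_append_def)

section \<open>A second-order binomial estimate\<close>

text \<open>The term linear in \<open>y\<close> is kept exactly, because its expectation will
  vanish. Every later monomial has degree at least 2 in \<open>y\<close> and lies below the sum of
  the two extreme ones; the binomial coefficients add up to at most 2^(2k+2).\<close>

lemma power_add_le_second_order:
  fixes s y :: real
  shows "(s + y) ^ (2 * k + 2) \<le> s ^ (2 * k + 2) + real (2 * k + 2) * (s ^ (2 * k + 1) * y)
    + 2 ^ (2 * k + 2) * (s ^ (2 * k) * y\<^sup>2 + y ^ (2 * k + 2))"
proof -
  define B where "B = s ^ (2 * k) * y\<^sup>2 + y ^ (2 * k + 2)"
  have ev: "0 \<le> s ^ (2 * k) * y\<^sup>2" "0 \<le> y ^ (2 * k + 2)"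
    by (auto simp: zero_le_even_power simp del: power_Suc power_add)
  then have B0: "0 \<le> B" unfolding B_def by linarith
  have monom_le: "y ^ (j + 2) * s ^ (2 * k - j) \<le> B" if "j \<le> 2 * k" for j
  proof -
    have "y ^ (j + 2) * s ^ (2 * k - j) \<le> \<bar>y\<bar> ^ (j + 2) * \<bar>s\<bar> ^ (2 * k - j)"
      by (metis abs_ge_self abs_mult power_abs)
    also have "\<dots> \<le> B"
    \<comment> \<open>The smaller of the two bases is replaced by the larger one, except that a
      factor y^2 is always retained.\<close>
    proof (cases "\<bar>y\<bar> \<le> \<bar>s\<bar>")
      case True
      have "\<bar>y\<bar> ^ (j + 2) * \<bar>s\<bar> ^ (2 * k - j) = \<bar>y\<bar> ^ j * \<bar>s\<bar> ^ (2 * k - j) * y\<^sup>2"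
        by (simp add: power_add power2_eq_square)
      also have "\<dots> \<le> \<bar>s\<bar> ^ j * \<bar>s\<bar> ^ (2 * k - j) * y\<^sup>2"
        by (intro mult_right_mono power_mono True) auto
      also have "\<dots> = s ^ (2 * k) * y\<^sup>2"
        using that by (simp add: power_add[symmetric] power_even_abs)
      also have "\<dots> \<le> B" unfolding B_def using ev by linarith
      finally show ?thesis .
    next
      case False
      have "\<bar>y\<bar> ^ (j + 2) * \<bar>s\<bar> ^ (2 * k - j) \<le> \<bar>y\<bar> ^ (j + 2) * \<bar>y\<bar> ^ (2 * k - j)"
        using False by (intro mult_left_mono power_mono) auto
      also have "\<dots> = \<bar>y\<bar> ^ (2 * k + 2)"
        using that by (simp only: power_add[symmetric]) (simp add: algebra_simps)
      also have "\<dots> = y ^ (2 * k + 2)"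
        by (rule power_even_abs) simp
      also have "\<dots> \<le> B" unfolding B_def using ev by linarith
      finally show ?thesis .
    qed
    finally show ?thesis .
  qed
  let ?N = "2 * k + 2"
  have N: "?N = Suc (Suc (2 * k))" by simp
  have "(s + y) ^ ?N = (\<Sum>j\<le>?N. real (?N choose j) * y ^ j * s ^ (?N - j))"
    \<comment> \<open>After swapping the summands, \<open>j\<close> counts the powers of
      \<open>y\<close>.\<close>
    by (subst add.commute) (rule binomial_ring)
  also have "\<dots> = s ^ ?N + (real ?N * (s ^ (2 * k + 1) * y)
      + (\<Sum>j\<le>2 * k. real (?N choose (j + 2)) * (y ^ (j + 2) * s ^ (2 * k - j))))"
    unfolding N by (subst sum.atMost_Suc_shift)+ (simp add: mult_ac)
  also have "(\<Sum>j\<le>2 * k. real (?N choose (j + 2)) * (y ^ (j + 2) * s ^ (2 * k - j)))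
      \<le> (\<Sum>j\<le>2 * k. real (?N choose (j + 2)) * B)"
    by (intro sum_mono mult_left_mono monom_le) auto
  also have "\<dots> = real (\<Sum>j\<le>2 * k. ?N choose (j + 2)) * B"
    by (simp add: sum_distrib_right)
  also have "\<dots> \<le> 2 ^ ?N * B"
  proof (rule mult_right_mono[OF _ B0])
    have "(\<Sum>j\<le>2 * k. ?N choose (j + 2)) \<le> (\<Sum>j\<le>?N. ?N choose j)"
      unfolding N by (simp add: sum.atMost_Suc_shift del: sum.atMost_Suc)
    also have "\<dots> = 2 ^ ?N" by (rule choose_row_sum)
    finally show "real (\<Sum>j\<le>2 * k. ?N choose (j + 2)) \<le> 2 ^ ?N"
      by (metis of_nat_le_iff of_nat_numeral of_nat_power)
  qed
  finally show ?thesis unfolding B_def by simp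
qed

section \<open>Sublinearity of the extended expectation\<close>

lemma upper_expectation_mono:
  "(\<And>\<omega>. f \<omega> \<le> g \<omega>) \<Longrightarrow> upper_expectation \<P> f \<le> upper_expectation \<P> g"
  unfolding upper_expectation_def by (intro SUP_mono) (auto intro: nn_integral_mono)

lemma upper_expectation_add_le:
  assumes "\<And>P. P \<in> \<P> \<Longrightarrow> f \<in> borel_measurable P" "\<And>P. P \<in> \<P> \<Longrightarrow> g \<in> borel_measurable P"
  shows "upper_expectation \<P> (\<lambda>\<omega>. f \<omega> + g \<omega>) \<le> upper_expectation \<P> f + upper_expectation \<P> g"
  unfolding upper_expectation_def
proof (rule SUP_least)
  fix P assume P: "P \<in> \<P>"
  have "(\<integral>\<^sup>+\<omega>. f \<omega> + g \<omega> \<partial>P) = integral\<^sup>N P f + integral\<^sup>N P g"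
    using assms[OF P] by (rule nn_integral_add)
  also have "\<dots> \<le> (SUP P\<in>\<P>. integral\<^sup>N P f) + (SUP P\<in>\<P>. integral\<^sup>N P g)"
    using P by (intro add_mono SUP_upper)
  finally show "(\<integral>\<^sup>+\<omega>. f \<omega> + g \<omega> \<partial>P) \<le> (SUP P\<in>\<P>. integral\<^sup>N P f) + (SUP P\<in>\<P>. integral\<^sup>N P g)" .
qed

lemma upper_expectation_cmult:
  assumes "\<And>P. P \<in> \<P> \<Longrightarrow> f \<in> borel_measurable P"
  shows "upper_expectation \<P> (\<lambda>\<omega>. c * f \<omega>) = c * upper_expectation \<P> f"
  unfolding upper_expectation_def SUP_mult_left_ennreal
  by (intro SUP_cong refl nn_integral_cmult assms)

section \<open>Algebra of the space and consequences of sublinearity\<close>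

context sublinear_expectation_space
begin

text \<open>The product of two coordinates is locally Lipschitz with polynomial growth, so
  \<open>H\<close> is an algebra and every polynomial in its members has a real expectation.\<close>

lemma H_mult:
  assumes "U \<in> H" "V \<in> H"
  shows "(\<lambda>\<omega>. U \<omega> * V \<omega>) \<in> H"
proof -
  have "(\<lambda>x. x 0 * x 1) \<in> C_llip 2" by (intro C_llip_intros) auto
  from H_C_llip[OF this, of "\<lambda>i. if i = 0 then U else V"] show ?thesis using assms by auto
qed

lemma H_power: "U \<in> H \<Longrightarrow> (\<lambda>\<omega>. U \<omega> ^ k) \<in> H"
  by (induction k) (auto intro: H_mult H_const)

lemma H_uminus: "U \<in> H \<Longrightarrow> (\<lambda>\<omega>. - U \<omega>) \<in> H"
  using H_scale[of U "-1"] by simp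

lemma H_diff: "U \<in> H \<Longrightarrow> V \<in> H \<Longrightarrow> (\<lambda>\<omega>. U \<omega> - V \<omega>) \<in> H"
  using H_add[of U "\<lambda>\<omega>. - V \<omega>"] H_uminus by simp

lemma H_sum: "(\<And>i. i \<in> I \<Longrightarrow> U i \<in> H) \<Longrightarrow> (\<lambda>\<omega>. \<Sum>i\<in>I. U i \<omega>) \<in> H"
  by (induction I rule: infinite_finite_induct) (auto intro: H_add H_const)

lemmas H_intros = H_const H_add H_diff H_uminus H_mult H_power H_sum H_abs

lemma H_measurable: "U \<in> H \<Longrightarrow> P \<in> \<P> \<Longrightarrow> U \<in> borel_measurable P"
  using integrable_H by blast

text \<open>A summand of certain mean zero drops out. The lower bound is subadditivity applied to U
  = (U + V) + (-V).\<close>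

lemma E_add_eq:
  assumes "U \<in> H" "V \<in> H" "E V = 0" "E (\<lambda>\<omega>. - V \<omega>) = 0"
  shows "E (\<lambda>\<omega>. U \<omega> + V \<omega>) = E U"
proof (rule antisym)
  show "E (\<lambda>\<omega>. U \<omega> + V \<omega>) \<le> E U" using E_subadd[OF assms(1,2)] assms(3) by simp
  show "E U \<le> E (\<lambda>\<omega>. U \<omega> + V \<omega>)"
    using E_subadd[OF H_add[OF assms(1,2)] H_uminus[OF assms(2)]] assms(4) by simp
qed

lemma E_add_const:
  assumes "U \<in> H"
  shows "E (\<lambda>\<omega>. U \<omega> + c) = E U + c"
proof (rule antisym)
  show "E (\<lambda>\<omega>. U \<omega> + c) \<le> E U + c"
    using E_subadd[OF assms H_const[of c]] by (simp add: E_const)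
  show "E U + c \<le> E (\<lambda>\<omega>. U \<omega> + c)"
    using E_subadd[OF H_add[OF assms H_const[of c]] H_const[of "-c"]] by (simp add: E_const)
qed

lemma E_nonneg: "U \<in> H \<Longrightarrow> (\<And>\<omega>. 0 \<le> U \<omega>) \<Longrightarrow> 0 \<le> E U"
  using E_mono[OF _ H_const[of 0]] by (simp add: E_const)

text \<open>
  The finiteness conditions in \<open>independent_to\<close> hold automatically: by polynomial growth,
  \<open>\<bar>\<phi>(x, y)\<bar>\<close> is dominated by a product \<open>f(x) g(y)\<close> of polynomially growing functions.
\<close>

lemma independent_toD:
  assumes indep: "independent_to E \<P> 1 Y n Z"
    and \<phi>: "\<phi> \<in> C_llip (Suc n)" and Y: "Y 0 \<in> H" and Z: "\<And>i. i < n \<Longrightarrow> Z i \<in> H"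
  shows "E (\<lambda>\<omega>. \<phi> (vec_append n (\<lambda>i. Z i \<omega>) (\<lambda>j. Y j \<omega>))) =
    E (\<lambda>\<omega>. E (\<lambda>\<omega>'. \<phi> (vec_append n (\<lambda>i. Z i \<omega>) (\<lambda>j. Y j \<omega>'))))"
proof -
  obtain C m where C: "0 \<le> C" and growth: "\<And>x. \<bar>\<phi> x\<bar> \<le> C * (1 + L2_set x {..<Suc n}) ^ m"
    using C_llip_growth[OF \<phi>] by blast
  \<comment> \<open>The sum of absolute values replaces the Euclidean norm, so that the bound splits
    into a factor in \<open>x\<close> and a factor in \<open>Y 0\<close>, and substituting
    \<open>Z\<close> into \<open>f\<close> stays in \<open>H\<close>.\<close>
  define f :: "(nat \<Rightarrow> real) \<Rightarrow> real" where "f = (\<lambda>x. C * (1 + (\<Sum>i<n. \<bar>x i\<bar>)) ^ m)"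
  define g where "g = (\<lambda>\<omega>. (1 + \<bar>Y 0 \<omega>\<bar>) ^ m)"
  have f0: "0 \<le> f x" for x unfolding f_def using C by (auto intro!: mult_nonneg_nonneg add_nonneg_nonneg sum_nonneg)
  have gH: "g \<in> H" unfolding g_def by (intro H_intros Y)
  have g0: "0 \<le> g \<omega>" for \<omega> unfolding g_def by auto
  have le: "\<bar>\<phi> (vec_append n x (\<lambda>j. Y j \<omega>))\<bar> \<le> f x * g \<omega>" for x \<omega>
  proof -
    let ?z = "vec_append n x (\<lambda>j. Y j \<omega>)"
    let ?s = "\<Sum>i<n. \<bar>x i\<bar>"
    have s0: "0 \<le> ?s" by (simp add: sum_nonneg)
    have "L2_set ?z {..<Suc n} \<le> (\<Sum>i<Suc n. \<bar>?z i\<bar>)"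
      by (rule L2_set_le_sum_abs)
    also have "\<dots> = ?s + \<bar>Y 0 \<omega>\<bar>"
      by (simp add: vec_append_less vec_append_last)
    \<comment> \<open>The cross term of the product is nonnegative, so the sum may be replaced by
      the separated product.\<close>
    finally have "1 + L2_set ?z {..<Suc n} \<le> (1 + ?s) * (1 + \<bar>Y 0 \<omega>\<bar>)"
      using mult_nonneg_nonneg[OF s0 abs_ge_zero[of "Y 0 \<omega>"]]
      unfolding distrib_left distrib_right by linarith
    then have "(1 + L2_set ?z {..<Suc n}) ^ m \<le> ((1 + ?s) * (1 + \<bar>Y 0 \<omega>\<bar>)) ^ m"
      by (intro power_mono) auto
    then have "C * (1 + L2_set ?z {..<Suc n}) ^ m \<le> C * ((1 + ?s) * (1 + \<bar>Y 0 \<omega>\<bar>)) ^ m"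
      using C by (intro mult_left_mono)
    then show ?thesis using growth[of ?z] unfolding f_def g_def by (simp add: power_mult_distrib)
  qed
  define bar where
    "bar = (\<lambda>x. upper_expectation \<P> (\<lambda>\<omega>. ennreal \<bar>\<phi> (vec_append n x (\<lambda>j. Y j \<omega>))\<bar>))"
  have bar: "bar x \<le> ennreal (f x * E g)" for x
  proof -
    have "bar x \<le> upper_expectation \<P> (\<lambda>\<omega>. ennreal (f x * g \<omega>))"
      unfolding bar_def by (intro upper_expectation_mono ennreal_leI le)
    also have "\<dots> = ennreal (E (\<lambda>\<omega>. f x * g \<omega>))"
      using f0 g0 by (intro upper_expectation_eq H_intros gH) auto
    also have "E (\<lambda>\<omega>. f x * g \<omega>) = f x * E g"
      by (rule E_scale[OF gH f0])
    finally show ?thesis .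
  qed
  have fH: "(\<lambda>\<omega>. f (\<lambda>i. Z i \<omega>)) \<in> H"
    unfolding f_def by (intro H_intros Z) auto
  have "upper_expectation \<P> (\<lambda>\<omega>. bar (\<lambda>i. Z i \<omega>))
      \<le> upper_expectation \<P> (\<lambda>\<omega>. ennreal (f (\<lambda>i. Z i \<omega>) * E g))"
    by (intro upper_expectation_mono bar)
  also have "\<dots> = ennreal (E (\<lambda>\<omega>. f (\<lambda>i. Z i \<omega>) * E g))"
    using f0 E_nonneg[OF gH g0] by (intro upper_expectation_eq H_intros fH) auto
  also have "\<dots> < \<infinity>" by simp
  finally have fin: "upper_expectation \<P> (\<lambda>\<omega>. bar (\<lambda>i. Z i \<omega>)) < \<infinity>" .
  have "bar x < \<infinity>" for x
    using bar[of x] by (simp add: le_less_trans)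
  then show ?thesis
    using indep \<phi> fin unfolding independent_to_def Let_def bar_def by simp
qed

end

section \<open>Centred i.i.d. sums with certain mean\<close>

text \<open>The mean is prescribed for \<open>X 1\<close> alone; the other variables inherit it by
  identical distribution.\<close>

locale certain_mean_iid = sublinear_expectation_space H E \<P>
  for H :: "('a::polish_space \<Rightarrow> real) set" and E and \<P> +
  fixes X :: "nat \<Rightarrow> 'a \<Rightarrow> real" and \<mu> :: real
  assumes iid: "iid_sequence H E \<P> X"
    and mean: "E (X 1) = \<mu>" "E (\<lambda>\<omega>. - X 1 \<omega>) = - \<mu>"
begin

definition Y :: "nat \<Rightarrow> 'a \<Rightarrow> real" where "Y n \<omega> = X n \<omega> - \<mu>"

definition T :: "nat \<Rightarrow> 'a \<Rightarrow> real" where "T n \<omega> = (\<Sum>i<n. Y (Suc i) \<omega>)"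

text \<open>The upper variance of the summands.\<close>

definition \<sigma>2 :: real where "\<sigma>2 = E (\<lambda>\<omega>. Y 1 \<omega> ^ 2)"

lemma X_H: "X (Suc i) \<in> H"
  using iid unfolding iid_sequence_def by auto

lemma Y_H: "Y (Suc i) \<in> H"
  unfolding Y_def[abs_def] by (intro H_intros X_H)

lemma T_H: "T n \<in> H"
  unfolding T_def[abs_def] by (intro H_intros Y_H)

lemma T_0: "T 0 \<omega> = 0" and T_Suc: "T (Suc n) \<omega> = T n \<omega> + Y (Suc n) \<omega>"
  by (simp_all add: T_def)

text \<open>Composing the test function with the shift by \<mu> transfers identical distribution
  from the \<open>X i\<close> to the centred \<open>Y i\<close>.\<close>

lemma E_Y_cong:
  assumes "(\<lambda>x. f (x 0 - \<mu>)) \<in> C_llip 1"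
  shows "E (\<lambda>\<omega>. f (Y (Suc i) \<omega>)) = E (\<lambda>\<omega>. f (Y 1 \<omega>))"
proof -
  have "identically_distributed E (X (Suc i)) (X 1)"
    using iid unfolding iid_sequence_def by auto
  from this[unfolded identically_distributed_def, rule_format, OF assms]
  show ?thesis by (simp add: Y_def)
qed

lemma E_Y_power: "E (\<lambda>\<omega>. Y (Suc i) \<omega> ^ k) = E (\<lambda>\<omega>. Y 1 \<omega> ^ k)"
  by (rule E_Y_cong) (intro C_llip_intros, simp)

text \<open>This is where certainty of the mean enters: positive homogeneity handles nonnegative
  \<open>c\<close> through E[Y] = 0 and negative \<open>c\<close> through E[-Y] = 0.\<close>

lemma E_cmult_Y: "E (\<lambda>\<omega>. c * Y (Suc i) \<omega>) = 0"
proof -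
  have "E (\<lambda>\<omega>. c * Y (Suc i) \<omega>) = E (\<lambda>\<omega>. c * Y 1 \<omega>)"
    by (rule E_Y_cong) (intro C_llip_intros, simp)
  also have "\<dots> = 0"
  proof (cases "0 \<le> c")
    case True
    have "E (Y 1) = 0"
      using E_add_const[OF X_H[of 0], of "- \<mu>"] mean by (simp add: Y_def[abs_def])
    then show ?thesis using E_scale[OF Y_H[of 0] True] by simp
  next
    case False
    have "E (\<lambda>\<omega>. - Y 1 \<omega>) = 0"
      using E_add_const[OF H_uminus[OF X_H[of 0]], of \<mu>] mean by (simp add: Y_def[abs_def])
    then show ?thesis using E_scale[OF H_uminus[OF Y_H[of 0]], of "- c"] False by simp
  qed
  finally show ?thesis .
qed

text \<open>A Fubini rule: the newest variable is integrated out first, with the earlier sum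
  frozen.\<close>

lemma E_T_Y_eq:
  assumes "(\<lambda>x. \<psi> (\<Sum>i<n. x i - \<mu>) (x n - \<mu>)) \<in> C_llip (Suc n)"
  shows "E (\<lambda>\<omega>. \<psi> (T n \<omega>) (Y (Suc n) \<omega>)) = E (\<lambda>\<omega>. E (\<lambda>\<omega>'. \<psi> (T n \<omega>) (Y (Suc n) \<omega>')))"
proof (cases "n = 0")
  case True
  then show ?thesis by (simp add: T_0 E_const)
next
  case False
  then have "independent_to E \<P> 1 (\<lambda>_. X (n + 1)) n (\<lambda>k. X (k + 1))"
    using iid unfolding iid_sequence_def by auto
  from independent_toD[OF this assms] X_H show ?thesis
    by (simp add: vec_append_less vec_append_last T_def Y_def)
qed

text \<open>With the sum frozen, a multiple of \<open>Y\<close> of either sign remains, and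
  \<open>E_cmult_Y\<close> covers both signs.\<close>

lemma E_T_power_mult_Y: "E (\<lambda>\<omega>. T n \<omega> ^ k * Y (Suc n) \<omega>) = 0"
proof -
  have "E (\<lambda>\<omega>. T n \<omega> ^ k * Y (Suc n) \<omega>) = E (\<lambda>\<omega>. E (\<lambda>\<omega>'. T n \<omega> ^ k * Y (Suc n) \<omega>'))"
    by (rule E_T_Y_eq[of "\<lambda>s y. s ^ k * y"]) (intro C_llip_intros; simp)
  then show ?thesis by (simp add: E_cmult_Y E_const)
qed

lemma E_T_even_power_mult_Y2:
  "E (\<lambda>\<omega>. T n \<omega> ^ (2 * k) * Y (Suc n) \<omega> ^ 2) = E (\<lambda>\<omega>. T n \<omega> ^ (2 * k)) * \<sigma>2"
proof -
  have "E (\<lambda>\<omega>. T n \<omega> ^ (2 * k) * Y (Suc n) \<omega> ^ 2)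
      = E (\<lambda>\<omega>. E (\<lambda>\<omega>'. T n \<omega> ^ (2 * k) * Y (Suc n) \<omega>' ^ 2))"
    by (rule E_T_Y_eq[of "\<lambda>s y. s ^ (2 * k) * y ^ 2"]) (intro C_llip_intros; simp)
  also have "\<dots> = E (\<lambda>\<omega>. \<sigma>2 * T n \<omega> ^ (2 * k))"
  proof -
    have "E (\<lambda>\<omega>'. T n \<omega> ^ (2 * k) * Y (Suc n) \<omega>' ^ 2) = T n \<omega> ^ (2 * k) * E (\<lambda>\<omega>'. Y (Suc n) \<omega>' ^ 2)" for \<omega>
      by (intro E_scale H_intros Y_H) (simp add: zero_le_even_power)
    then show ?thesis by (simp only: E_Y_power \<sigma>2_def mult.commute)
  qed
  also have "\<dots> = \<sigma>2 * E (\<lambda>\<omega>. T n \<omega> ^ (2 * k))"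
    using H_power[OF Y_H[of 0]] by (intro E_scale H_intros T_H) (auto simp: \<sigma>2_def intro!: E_nonneg)
  finally show ?thesis by simp
qed

section \<open>Second and higher even moments of the sums\<close>

text \<open>Equality holds despite sublinearity: once the sum is frozen at \<open>s\<close>, s^2 is
  a constant and the cross term has certain mean zero.\<close>

lemma E_T_square: "E (\<lambda>\<omega>. T n \<omega> ^ 2) = real n * \<sigma>2"
proof (induction n)
  case 0
  then show ?case by (simp add: T_0 E_const)
next
  case (Suc n)
  have inner: "E (\<lambda>\<omega>. (s + Y (Suc n) \<omega>) ^ 2) = s ^ 2 + \<sigma>2" for s
  proof -
    have "E (\<lambda>\<omega>. (s + Y (Suc n) \<omega>) ^ 2)
        = E (\<lambda>\<omega>. (Y (Suc n) \<omega> ^ 2 + s ^ 2) + (2 * s) * Y (Suc n) \<omega>)"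
      by (simp add: power2_eq_square algebra_simps)
    also have "\<dots> = E (\<lambda>\<omega>. Y (Suc n) \<omega> ^ 2 + s ^ 2)"
      using E_cmult_Y[of "2 * s" n] E_cmult_Y[of "- (2 * s)" n]
      by (intro E_add_eq H_intros Y_H) auto
    also have "\<dots> = E (\<lambda>\<omega>. Y (Suc n) \<omega> ^ 2) + s ^ 2"
      by (intro E_add_const H_intros Y_H)
    finally show ?thesis by (simp only: E_Y_power \<sigma>2_def add.commute)
  qed
  have "E (\<lambda>\<omega>. (T n \<omega> + Y (Suc n) \<omega>) ^ 2) = E (\<lambda>\<omega>. E (\<lambda>\<omega>'. (T n \<omega> + Y (Suc n) \<omega>') ^ 2))"
    by (rule E_T_Y_eq[of "\<lambda>s y. (s + y) ^ 2"]) (intro C_llip_intros; simp)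
  also have "\<dots> = E (\<lambda>\<omega>. T n \<omega> ^ 2) + \<sigma>2"
    unfolding inner by (intro E_add_const H_intros T_H)
  finally show ?case using Suc by (simp add: T_Suc algebra_simps)
qed

text \<open>The bound of order 2k controls the quadratic term of
  \<open>power_add_le_second_order\<close>. The moment of order 2k + 2 thus grows by at most D
  (n+1)^k per step, and summation gains one power of n.\<close>

lemma E_T_even_power_le: "\<exists>C\<ge>0. \<forall>n. E (\<lambda>\<omega>. T n \<omega> ^ (2 * k)) \<le> C * real n ^ k"
proof (induction k)
  case 0
  then show ?case by (intro exI[of _ 1]) (simp add: E_const)
next
  case (Suc k)
  then obtain C where C: "0 \<le> C" and le: "\<And>n. E (\<lambda>\<omega>. T n \<omega> ^ (2 * k)) \<le> C * real n ^ k" by blast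
  define M where "M = E (\<lambda>\<omega>. Y 1 \<omega> ^ (2 * k + 2))"
  have M0: "0 \<le> M" unfolding M_def using H_power[OF Y_H[of 0], of "2 * k + 2"]
    by (intro E_nonneg) (simp_all add: zero_le_even_power del: power_Suc power_add)
  have \<sigma>0: "0 \<le> \<sigma>2" unfolding \<sigma>2_def using H_power[OF Y_H[of 0]] by (intro E_nonneg) auto
  \<comment> \<open>The power of 2 comes from the binomial estimate, C \<sigma>2 from its quadratic
    term and \<open>M\<close> from its top power of \<open>Y\<close>.\<close>
  define D where "D = 2 ^ (2 * k + 2) * (C * \<sigma>2 + M)"
  have D0: "0 \<le> D" unfolding D_def using C M0 \<sigma>0 by simp
  have step: "E (\<lambda>\<omega>. T (Suc n) \<omega> ^ (2 * k + 2)) \<le> E (\<lambda>\<omega>. T n \<omega> ^ (2 * k + 2)) + D * real (Suc n) ^ k" for n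
  proof -
    let ?Y = "Y (Suc n)"
    define K where "K = (2::real) ^ (2 * k + 2)"
    have K0: "0 \<le> K" by (simp add: K_def)
    define A1 where "A1 = (\<lambda>\<omega>. T n \<omega> ^ (2 * k + 2))"
    define A2 where "A2 = (\<lambda>\<omega>. real (2 * k + 2) * (T n \<omega> ^ (2 * k + 1) * ?Y \<omega>))"
    define A3 where "A3 = (\<lambda>\<omega>. T n \<omega> ^ (2 * k) * ?Y \<omega> ^ 2)"
    define A4 where "A4 = (\<lambda>\<omega>. ?Y \<omega> ^ (2 * k + 2))"
    have AH: "A1 \<in> H" "A2 \<in> H" "A3 \<in> H" "A4 \<in> H"
      unfolding A1_def A2_def A3_def A4_def by (intro H_intros T_H Y_H)+
    have E2: "E A2 = 0"
      unfolding A2_def by (subst E_scale) (auto intro!: H_intros T_H Y_H simp: E_T_power_mult_Y simp del: power_Suc)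
    have "E (\<lambda>\<omega>. T (Suc n) \<omega> ^ (2 * k + 2)) \<le> E (\<lambda>\<omega>. (A1 \<omega> + A2 \<omega>) + K * (A3 \<omega> + A4 \<omega>))"
      unfolding A1_def A2_def A3_def A4_def T_Suc K_def
      by (rule E_mono[OF _ _ power_add_le_second_order]) (intro H_intros T_H Y_H)+
    also have "\<dots> \<le> E (\<lambda>\<omega>. A1 \<omega> + A2 \<omega>) + E (\<lambda>\<omega>. K * (A3 \<omega> + A4 \<omega>))"
      by (intro E_subadd H_intros AH)
    also have "E (\<lambda>\<omega>. A1 \<omega> + A2 \<omega>) \<le> E A1 + E A2"
      by (intro E_subadd AH)
    also have "E (\<lambda>\<omega>. K * (A3 \<omega> + A4 \<omega>)) = K * E (\<lambda>\<omega>. A3 \<omega> + A4 \<omega>)"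
      by (intro E_scale H_intros AH K0)
    also have "E (\<lambda>\<omega>. A3 \<omega> + A4 \<omega>) \<le> E A3 + E A4"
      by (intro E_subadd AH)
    also have "E A4 = M" unfolding A4_def M_def by (rule E_Y_power)
    also have "E A3 = E (\<lambda>\<omega>. T n \<omega> ^ (2 * k)) * \<sigma>2"
      unfolding A3_def by (rule E_T_even_power_mult_Y2)
    \<comment> \<open>The base \<open>Suc n\<close> is at least 1, so its power absorbs
      \<open>M\<close> even for \<open>n = 0\<close>.\<close>
    also have "E (\<lambda>\<omega>. T n \<omega> ^ (2 * k)) * \<sigma>2 + M \<le> (C * \<sigma>2 + M) * real (Suc n) ^ k"
    proof -
      have "E (\<lambda>\<omega>. T n \<omega> ^ (2 * k)) * \<sigma>2 \<le> C * real (Suc n) ^ k * \<sigma>2"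
        using C by (intro mult_right_mono order_trans[OF le] mult_left_mono power_mono \<sigma>0) auto
      moreover have "M * 1 \<le> M * real (Suc n) ^ k"
        by (intro mult_left_mono one_le_power M0) auto
      ultimately show ?thesis by (simp add: algebra_simps)
    qed
    finally show ?thesis using K0 E2 unfolding D_def K_def[symmetric] A1_def
      by (simp add: mult.assoc mult_left_mono)
  qed
  have "E (\<lambda>\<omega>. T n \<omega> ^ (2 * k + 2)) \<le> D * real n ^ Suc k" for n
  proof (induction n)
    case 0
    then show ?case by (simp add: T_0 E_const)
  next
    case (Suc n)
    have "E (\<lambda>\<omega>. T (Suc n) \<omega> ^ (2 * k + 2)) \<le> D * real n ^ Suc k + D * real (Suc n) ^ k"
      using step[of n] Suc by linarith
    \<comment> \<open>After this replacement the two terms add up to exactly D (n+1)^(k+1).\<close>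
    also have "real n ^ Suc k \<le> real n * real (Suc n) ^ k"
      by (auto intro!: mult_left_mono power_mono)
    then have "D * real n ^ Suc k + D * real (Suc n) ^ k \<le> D * (real n * real (Suc n) ^ k) + D * real (Suc n) ^ k"
      using D0 by (intro add_mono mult_left_mono) auto
    also have "\<dots> = D * real (Suc n) ^ Suc k"
      by (simp add: algebra_simps)
    finally show ?case .
  qed
  then show ?case using D0 by (intro exI[of _ D]) simp
qed

section \<open>Convergence for exponents above 2\<close>

lemma SLp_converges_mean_iff:
  "SLp_converges \<P> p (\<lambda>n \<omega>. (\<Sum>i=1..n. X i \<omega>) / real n) (\<lambda>_. \<mu>) \<longleftrightarrow>
    (\<Sum>n. upper_expectation \<P> (\<lambda>\<omega>. ennreal (\<bar>T (Suc n) \<omega> / real (Suc n)\<bar> powr p))) < \<infinity>"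
proof -
  have "(\<Sum>i=1..Suc n. X i \<omega>) / real (Suc n) - \<mu> = T (Suc n) \<omega> / real (Suc n)" for n \<omega>
  proof -
    have "(\<Sum>i=1..Suc n. X i \<omega>) = (\<Sum>i<Suc n. X (Suc i) \<omega>)"
      using sum.atLeast1_atMost_eq[of "\<lambda>i. X i \<omega>" "Suc n"] by simp
    also have "\<dots> = T (Suc n) \<omega> + real (Suc n) * \<mu>"
      unfolding T_def Y_def by (simp add: sum_subtractf algebra_simps)
    finally show ?thesis by (simp add: field_simps)
  qed
  then show ?thesis unfolding SLp_converges_def by simp
qed

text \<open>Normalised by sqrt N, the sum has bounded even moments. The remaining factor N^(-p/2) is
  summable exactly because p/2 > 1.\<close>

lemma SLp_converges_mean:
  assumes p: "2 < p"
  shows "SLp_converges \<P> p (\<lambda>n \<omega>. (\<Sum>i=1..n. X i \<omega>) / real n) (\<lambda>_. \<mu>)"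
proof -
  define k where "k = nat \<lceil>p\<rceil>"
  have k: "p \<le> real (2 * k)" using p unfolding k_def by linarith
  obtain C where C: "0 \<le> C" and le: "\<And>n. E (\<lambda>\<omega>. T n \<omega> ^ (2 * k)) \<le> C * real n ^ k"
    using E_T_even_power_le by blast
  have bound: "upper_expectation \<P> (\<lambda>\<omega>. ennreal (\<bar>T (Suc n) \<omega> / real (Suc n)\<bar> powr p))
      \<le> ennreal ((1 + C) * real (Suc n) powr (- (p / 2)))" for n
  proof -
    define N where "N = real (Suc n)"
    have N: "0 < N" by (simp add: N_def)
    have powr_le: "\<bar>t / N\<bar> powr p \<le> N powr (- (p / 2)) * (1 + inverse (N ^ k) * t ^ (2 * k))" for t
    proof -
      define r where "r = \<bar>t\<bar> / sqrt N"
      have r0: "0 \<le> r" using N by (simp add: r_def)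
      \<comment> \<open>This elementary bound does the work of a Lyapunov inequality: it reduces a
        real exponent to an even integer one, hence to a member of \<open>H\<close>.\<close>
      have "r powr p \<le> 1 + r ^ (2 * k)"
      proof (cases "r \<le> 1")
        case True
        then have "r powr p \<le> 1" using r0 p by (simp add: powr_le1)
        then show ?thesis by (smt (verit) r0 zero_le_power)
      next
        case False
        then have "r powr p \<le> r powr real (2 * k)" by (intro powr_mono k) auto
        also have "\<dots> = r ^ (2 * k)" using False by (intro powr_realpow) auto
        finally show ?thesis by simp
      qed
      also have "r ^ (2 * k) = inverse (N ^ k) * t ^ (2 * k)"
        using N unfolding r_def power_mult power_divide by (simp add: field_simps)
      finally have *: "r powr p \<le> 1 + inverse (N ^ k) * t ^ (2 * k)" .
      have "\<bar>t / N\<bar> = r * N powr (- (1 / 2))"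
        using N unfolding r_def by (simp add: powr_minus powr_half_sqrt field_simps)
      then have "\<bar>t / N\<bar> powr p = N powr (- (p / 2)) * r powr p"
        using r0 by (simp add: powr_mult powr_powr)
      then show ?thesis using * by (simp add: mult_left_mono)
    qed
    have "upper_expectation \<P> (\<lambda>\<omega>. ennreal (\<bar>T (Suc n) \<omega> / N\<bar> powr p))
        \<le> upper_expectation \<P> (\<lambda>\<omega>. ennreal (N powr (- (p / 2)) * (1 + inverse (N ^ k) * T (Suc n) \<omega> ^ (2 * k))))"
      by (intro upper_expectation_mono ennreal_leI powr_le)
    also have "\<dots> = ennreal (E (\<lambda>\<omega>. N powr (- (p / 2)) * (1 + inverse (N ^ k) * T (Suc n) \<omega> ^ (2 * k))))"
      using N by (intro upper_expectation_eq H_intros T_H mult_nonneg_nonneg add_nonneg_nonneg)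
        (auto simp: zero_le_even_power)
    also have "E (\<lambda>\<omega>. N powr (- (p / 2)) * (1 + inverse (N ^ k) * T (Suc n) \<omega> ^ (2 * k)))
        = N powr (- (p / 2)) * E (\<lambda>\<omega>. inverse (N ^ k) * T (Suc n) \<omega> ^ (2 * k) + 1)"
      by (subst E_scale) (auto intro!: H_intros T_H simp: add.commute)
    also have "E (\<lambda>\<omega>. inverse (N ^ k) * T (Suc n) \<omega> ^ (2 * k) + 1)
        = E (\<lambda>\<omega>. inverse (N ^ k) * T (Suc n) \<omega> ^ (2 * k)) + 1"
      by (intro E_add_const H_intros T_H)
    also have "E (\<lambda>\<omega>. inverse (N ^ k) * T (Suc n) \<omega> ^ (2 * k)) = inverse (N ^ k) * E (\<lambda>\<omega>. T (Suc n) \<omega> ^ (2 * k))"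
      using N by (intro E_scale H_intros T_H) auto
    also have "ennreal (N powr (- (p / 2)) * (inverse (N ^ k) * E (\<lambda>\<omega>. T (Suc n) \<omega> ^ (2 * k)) + 1))
        \<le> ennreal (N powr (- (p / 2)) * (C + 1))"
    proof (intro ennreal_leI mult_left_mono add_right_mono)
      have "inverse (N ^ k) * E (\<lambda>\<omega>. T (Suc n) \<omega> ^ (2 * k)) \<le> inverse (N ^ k) * (C * N ^ k)"
        using N unfolding N_def by (intro mult_left_mono le) auto
      also have "\<dots> = C" using N by simp
      finally show "inverse (N ^ k) * E (\<lambda>\<omega>. T (Suc n) \<omega> ^ (2 * k)) \<le> C" .
    qed auto
    finally show ?thesis unfolding N_def by (simp add: mult.commute add.commute)
  qed
  have "summable (\<lambda>n. real n powr (- (p / 2)))"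
    using p by (simp add: summable_real_powr_iff)
  then have sm: "summable (\<lambda>n. (1 + C) * real (Suc n) powr (- (p / 2)))"
    by (intro summable_mult) (simp add: summable_Suc_iff[of "\<lambda>n. real n powr (- (p / 2))"] del: of_nat_Suc)
  have "(\<Sum>n. upper_expectation \<P> (\<lambda>\<omega>. ennreal (\<bar>T (Suc n) \<omega> / real (Suc n)\<bar> powr p)))
      \<le> (\<Sum>n. ennreal ((1 + C) * real (Suc n) powr (- (p / 2))))"
    by (intro suminf_le bound) auto
  also have "\<dots> = ennreal (\<Sum>n. (1 + C) * real (Suc n) powr (- (p / 2)))"
    using C sm by (intro suminf_ennreal2) auto
  also have "\<dots> < \<infinity>" by simp
  finally show ?thesis unfolding SLp_converges_mean_iff .
qed

section \<open>Divergence for exponents up to 2\<close>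

text \<open>The inequality |y| <= y^2 / (2d) + d / 2 is weighted so that its constant takes only
  half of d = E|Y|; the other half must come from the variance.\<close>

lemma \<sigma>2_pos:
  assumes "0 < E (\<lambda>\<omega>. \<bar>X 1 \<omega> - \<mu>\<bar>)"
  shows "0 < \<sigma>2"
proof -
  define d where "d = E (\<lambda>\<omega>. \<bar>Y 1 \<omega>\<bar>)"
  have d: "0 < d" using assms by (simp add: d_def Y_def)
  have "\<bar>y\<bar> \<le> 1 / (2 * d) * y ^ 2 + d / 2" for y :: real
  proof -
    have "0 \<le> (\<bar>y\<bar> - d) ^ 2 / (2 * d)" using d by simp
    also have "\<dots> = 1 / (2 * d) * y ^ 2 + d / 2 - \<bar>y\<bar>"
      using d by (simp add: power2_diff field_simps power2_eq_square)
    finally show ?thesis by simp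
  qed
  then have "d \<le> E (\<lambda>\<omega>. 1 / (2 * d) * Y 1 \<omega> ^ 2 + d / 2)"
    unfolding d_def using Y_H[of 0] by (intro E_mono H_intros) simp_all
  also have "\<dots> = E (\<lambda>\<omega>. 1 / (2 * d) * Y 1 \<omega> ^ 2) + d / 2"
    using Y_H[of 0] by (intro E_add_const H_intros) simp
  also have "E (\<lambda>\<omega>. 1 / (2 * d) * Y 1 \<omega> ^ 2) = 1 / (2 * d) * \<sigma>2"
    using Y_H[of 0] d unfolding \<sigma>2_def by (intro E_scale H_intros) simp_all
  finally have "0 < 1 / (2 * d) * \<sigma>2" using d by linarith
  then show ?thesis using d by (simp add: zero_less_divide_iff)
qed

text \<open>The second moment of T/N is exactly \<sigma>2 / N. If the fourth moment accounts for at
  most half of it, the moment of order \<open>p\<close> must supply the rest, and the series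
  dominates a multiple of the harmonic one.\<close>

lemma not_SLp_converges_mean:
  assumes p: "0 < p" "p \<le> 2" and \<sigma>: "0 < \<sigma>2"
  shows "\<not> SLp_converges \<P> p (\<lambda>n \<omega>. (\<Sum>i=1..n. X i \<omega>) / real n) (\<lambda>_. \<mu>)"
proof
  define U where "U n = upper_expectation \<P> (\<lambda>\<omega>. ennreal (\<bar>T (Suc n) \<omega> / real (Suc n)\<bar> powr p))" for n
  assume "SLp_converges \<P> p (\<lambda>n \<omega>. (\<Sum>i=1..n. X i \<omega>) / real n) (\<lambda>_. \<mu>)"
  then have U: "(\<Sum>n. U n) < \<infinity>" unfolding SLp_converges_mean_iff U_def .
  obtain C where C_nonneg: "0 \<le> C" and fourth_le: "\<And>n. E (\<lambda>\<omega>. T n \<omega> ^ (2 * 2)) \<le> C * real n ^ 2"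
    using E_T_even_power_le[of 2] by blast
  \<comment> \<open>\<open>C + 1\<close> keeps \<open>A\<close> positive when
    \<open>C = 0\<close>.\<close>
  define A where "A = 2 * (C + 1) / \<sigma>2"
  have A: "0 < A" using C_nonneg \<sigma> by (simp add: A_def)
  \<comment> \<open>\<open>B\<close> bounds |t|^(2-p) whenever t^2 <= A, which follows from t^2 <= A
    / N; it is thus independent of \<open>n\<close>.\<close>
  define B where "B = A powr ((2 - p) / 2)"
  have bound: "ennreal (\<sigma>2 / (2 * real (Suc n))) \<le> ennreal B * U n" for n
  proof -
    define N where "N = real (Suc n)"
    have N: "1 \<le> N" by (simp add: N_def)
    define u where "u \<omega> = T (Suc n) \<omega> / N" for \<omega>
    have uH: "u \<in> H" unfolding u_def[abs_def] divide_inverse by (intro H_intros T_H)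
    have um: "u \<in> borel_measurable P" if "P \<in> \<P>" for P
      using H_measurable[OF uH that] .
    have eu: "(\<lambda>\<omega>. u \<omega> ^ j) = (\<lambda>\<omega>. (1 / N ^ j) * T (Suc n) \<omega> ^ j)" for j
      by (simp add: u_def fun_eq_iff power_divide)
    have E2: "E (\<lambda>\<omega>. u \<omega> ^ 2) = \<sigma>2 / N"
    proof -
      have "E (\<lambda>\<omega>. u \<omega> ^ 2) = 1 / N ^ 2 * (N * \<sigma>2)"
        unfolding eu N_def E_T_square[symmetric] by (intro E_scale H_intros T_H) simp
      then show ?thesis using N by (simp add: power2_eq_square)
    qed
    \<comment> \<open>Split according to whether \<open>t\<^sup>2\<close> exceeds \<open>A / N\<close>; this \<open>A\<close> makes the fourth-moment term at most
      half of \<open>E[u\<^sup>2] = \<sigma>\<^sup>2 / N\<close>.\<close>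
    have interpolation: "t ^ 2 \<le> B * \<bar>t\<bar> powr p + (N / A) * t ^ 4" for t
    proof (cases "N / A * t ^ 2 \<le> 1")
      case True
      then have "t ^ 2 \<le> A / N" using A N by (simp add: field_simps)
      also have "\<dots> \<le> A" using A N by (simp add: field_simps)
      finally have "t ^ 2 \<le> A" .
      have "\<bar>t\<bar> powr (2 - p) = (\<bar>t\<bar> powr 2) powr ((2 - p) / 2)"
        unfolding powr_powr by (simp add: diff_divide_distrib)
      also have "\<dots> = (t ^ 2) powr ((2 - p) / 2)"
        by (subst powr_numeral) simp_all
      also have "\<dots> \<le> B" unfolding B_def
        using \<open>t ^ 2 \<le> A\<close> p by (intro powr_mono2) auto
      finally have B: "\<bar>t\<bar> powr (2 - p) \<le> B" .
      \<comment> \<open>\<open>powr\<close> with base 0 is 0 for every exponent, so both sides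
        vanish at t = 0.\<close>
      have "t ^ 2 = \<bar>t\<bar> powr (2 - p) * \<bar>t\<bar> powr p"
        by (cases "t = 0") (simp_all add: powr_add[symmetric] powr_numeral)
      also have "\<dots> \<le> B * \<bar>t\<bar> powr p" using B by (intro mult_right_mono) auto
      also have "\<dots> \<le> B * \<bar>t\<bar> powr p + (N / A) * t ^ 4" using A N by simp
      finally show ?thesis .
    next
      case False
      then have "1 * t ^ 2 \<le> (N / A * t ^ 2) * t ^ 2" by (intro mult_right_mono) auto
      also have "\<dots> = (N / A) * t ^ 4" by (simp add: power4_eq_xxxx power2_eq_square)
      also have "\<dots> \<le> B * \<bar>t\<bar> powr p + (N / A) * t ^ 4" by (simp add: B_def)
      finally show ?thesis by simp
    qed
    have E4: "E (\<lambda>\<omega>. N / A * u \<omega> ^ 4) \<le> \<sigma>2 / (2 * N)"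
    proof -
      have "E (\<lambda>\<omega>. u \<omega> ^ 4) = 1 / N ^ 4 * E (\<lambda>\<omega>. T (Suc n) \<omega> ^ 4)"
        unfolding eu using N by (intro E_scale H_intros T_H) auto
      also have "\<dots> \<le> 1 / N ^ 4 * ((C + 1) * N ^ 2)"
      proof (intro mult_left_mono)
        have "E (\<lambda>\<omega>. T (Suc n) \<omega> ^ 4) \<le> C * N ^ 2"
          using fourth_le[of "Suc n"] unfolding N_def[symmetric] by simp
        also have "\<dots> \<le> (C + 1) * N ^ 2" by (intro mult_right_mono) auto
        finally show "E (\<lambda>\<omega>. T (Suc n) \<omega> ^ 4) \<le> (C + 1) * N ^ 2" .
      qed simp
      also have "\<dots> = (C + 1) / N ^ 2" using N by (simp add: field_simps power4_eq_xxxx power2_eq_square)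
      finally have "N / A * E (\<lambda>\<omega>. u \<omega> ^ 4) \<le> N / A * ((C + 1) / N ^ 2)"
        using A N by (intro mult_left_mono) auto
      also have "\<dots> = \<sigma>2 / (2 * N)"
      proof -
        have C1: "C + 1 = A * \<sigma>2 / 2" using \<sigma> by (simp add: A_def)
        show ?thesis unfolding C1 using A N by (simp add: power2_eq_square)
      qed
      also have "N / A * E (\<lambda>\<omega>. u \<omega> ^ 4) = E (\<lambda>\<omega>. N / A * u \<omega> ^ 4)"
        using A N by (intro E_scale[symmetric] H_intros uH) auto
      finally show ?thesis .
    qed
    \<comment> \<open>The two halves prepare the end of the chain, where the bound on the
      fourth-moment term is cancelled as a finite summand in \<open>ennreal\<close>.\<close>
    have "ennreal (\<sigma>2 / (2 * N)) + ennreal (\<sigma>2 / (2 * N)) = ennreal (E (\<lambda>\<omega>. u \<omega> ^ 2))"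
      using \<sigma> N unfolding E2 by (subst ennreal_plus[symmetric]) auto
    also have "\<dots> = upper_expectation \<P> (\<lambda>\<omega>. ennreal (u \<omega> ^ 2))"
      by (intro upper_expectation_eq[symmetric] H_intros uH) auto
    also have "\<dots> \<le> upper_expectation \<P> (\<lambda>\<omega>. ennreal B * ennreal (\<bar>u \<omega>\<bar> powr p) + ennreal (N / A * u \<omega> ^ 4))"
    proof (rule upper_expectation_mono)
      fix \<omega>
      have "ennreal (u \<omega> ^ 2) \<le> ennreal (B * \<bar>u \<omega>\<bar> powr p + N / A * u \<omega> ^ 4)"
        by (intro ennreal_leI interpolation)
      also have "\<dots> = ennreal B * ennreal (\<bar>u \<omega>\<bar> powr p) + ennreal (N / A * u \<omega> ^ 4)"
        using A N by (simp add: ennreal_plus ennreal_mult B_def)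
      finally show "ennreal (u \<omega> ^ 2) \<le> \<dots>" .
    qed
    also have "\<dots> \<le> upper_expectation \<P> (\<lambda>\<omega>. ennreal B * ennreal (\<bar>u \<omega>\<bar> powr p))
        + upper_expectation \<P> (\<lambda>\<omega>. ennreal (N / A * u \<omega> ^ 4))"
      by (intro upper_expectation_add_le) (use um in measurable)
    also have "upper_expectation \<P> (\<lambda>\<omega>. ennreal B * ennreal (\<bar>u \<omega>\<bar> powr p)) = ennreal B * U n"
      unfolding U_def N_def[symmetric] u_def[symmetric]
      by (intro upper_expectation_cmult) (use um in measurable)
    also have "upper_expectation \<P> (\<lambda>\<omega>. ennreal (N / A * u \<omega> ^ 4)) = ennreal (E (\<lambda>\<omega>. N / A * u \<omega> ^ 4))"
      using A N by (intro upper_expectation_eq H_intros uH) auto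
    also have "\<dots> \<le> ennreal (\<sigma>2 / (2 * N))"
      by (intro ennreal_leI E4)
    finally show ?thesis unfolding N_def
      by (simp add: ennreal_add_left_cancel_le add.commute[of "ennreal B * _"])
  qed
  have "(\<Sum>n. ennreal (\<sigma>2 / (2 * real (Suc n)))) \<le> (\<Sum>n. ennreal B * U n)"
    by (intro suminf_le bound) auto
  also have "\<dots> = ennreal B * (\<Sum>n. U n)" by (rule ennreal_suminf_cmult)
  also have "\<dots> < \<infinity>" using U by (simp add: ennreal_mult_less_top)
  finally have "(\<Sum>n. ennreal (\<sigma>2 / (2 * real (Suc n)))) \<noteq> \<top>" by simp
  then have "summable (\<lambda>n. \<sigma>2 / (2 * real (Suc n)))"
    using \<sigma> by (intro summable_suminf_not_top) auto
  then have "summable (\<lambda>n. (2 / \<sigma>2) * (\<sigma>2 / (2 * real (Suc n))))"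
    by (rule summable_mult)
  moreover have "(2 / \<sigma>2) * (\<sigma>2 / (2 * real (Suc n))) = inverse (real (Suc n))" for n
    using \<sigma> by (simp add: inverse_eq_divide del: of_nat_Suc)
  ultimately have "summable (\<lambda>n. inverse (real (Suc n)))" by simp
  then show False
    using not_summable_harmonic[where 'a = real] summable_Suc_iff[of "\<lambda>n. inverse (real n)"] by simp
qed

end

text \<open>The positivity premise in the first part excludes the degenerate case where
  \<open>X 1\<close> equals \<mu> almost surely under every measure in \<open>\<P>\<close>: all
  terms of the series are then zero and divergence fails.\<close>

theorem theorem3p1:
  fixes H :: "('a::polish_space \<Rightarrow> real) set"
    and E :: "('a \<Rightarrow> real) \<Rightarrow> real"
    and \<P> :: "'a measure set"
    and X :: "nat \<Rightarrow> 'a \<Rightarrow> real"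
    and \<mu> \<alpha> :: real
  assumes "sublinear_expectation_space H E \<P>"
    and "iid_sequence H E \<P> X"
    and "\<And>n. n \<ge> 1 \<Longrightarrow> E (X n) = \<mu> \<and> - E (\<lambda>\<omega>. - X n \<omega>) = \<mu>"
    and "\<alpha> > 2"
    and "upper_expectation \<P> (\<lambda>\<omega>. ennreal (\<bar>X 1 \<omega>\<bar> powr \<alpha>)) < \<infinity>"
  shows "(E (\<lambda>\<omega>. \<bar>X 1 \<omega> - \<mu>\<bar>) > 0 \<longrightarrow>
           (\<forall>p. 0 < p \<and> p \<le> 2 \<longrightarrow>
              \<not> SLp_converges \<P> p (\<lambda>n \<omega>. (\<Sum>i=1..n. X i \<omega>) / real n) (\<lambda>_. \<mu>))) \<and>
         (\<forall>p. 2 < p \<and> p \<le> \<alpha> \<longrightarrow>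
              SLp_converges \<P> p (\<lambda>n \<omega>. (\<Sum>i=1..n. X i \<omega>) / real n) (\<lambda>_. \<mu>))"
proof -
  interpret sublinear_expectation_space H E \<P> by fact
  have "E (X 1) = \<mu>" "E (\<lambda>\<omega>. - X 1 \<omega>) = - \<mu>"
    using assms(3)[of 1] by auto
  then interpret certain_mean_iid H E \<P> X \<mu>
    using assms(2) by unfold_locales
  show ?thesis
    using not_SLp_converges_mean[OF _ _ \<sigma>2_pos] SLp_converges_mean by blast
qed

end
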